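(* For any index ${\bf k}=(k_{1}, \ldots , k_{r}) \in {\mathbb N}^{r}$ with $r \ge 2$ and primitive $n$-th root of unity $\zeta_n$, it holds that \begin{align*} \omega_{n}({\bf k}; \zeta_{n})=(-1)^{k_{r}} \sum_{j=1}^{k_{r}}\binom{k_{r}-1}{j-1}(1-q)^{k_{r}-j} z_{n}(a^{j}(e_{k_{1}} \mathbin{\sqcup\!\sqcup}_\hbar \cdots \mathbin{\sqcup\!\sqcup}_\hbar e_{k_{r-1}}))\big|_{q=\zeta_n}. \end{align*}
   Context: Let $[m]=(1-q^m)/(1-q)$, $F_k(m)=q^{(k-1)m}/[m]^k$ ($k\in\mathbb{N}$), $F_{\hat1}(m)=q^m/[m]$, and for ${\bf k}\in(\mathbb{N}\sqcup\{\hat1\})^r$, $L_{\bf k}(t)=\sum_{m_1>\cdots>m_r>0}t^{m_1}\prod_aF_{k_a}(m_a)$. Let $\mathcal{C}=\mathbb{Q}[\hbar,\hbar^{-1}]$, $\mathfrak{H}=\mathcal{C}\langle a,b\rangle$, $e_{\hat1}=ab$, $e_k=a^{k-1}(a+\hbar)b$, $e_{\bf k}=e_{k_1}\cdots e_{k_r}$, $\widehat{\mathfrak{H}}^1$ the subalgebra freely generated by the $e_k$, and $\mathcal{L}:\widehat{\mathfrak{H}}^1\to\mathbb{C}[[t]]$ the $\mathcal{C}$-linear map $e_{\bf k}\mapsto L_{\bf k}(t)$ (with $\hbar$ acting as $1-q$). The product $\mathbin{\sqcup\!\sqcup}_\hbar$ on $\mathfrak{H}$ is $\mathcal{C}$-bilinear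 with $aw\mathbin{\sqcup\!\sqcup}_\hbar aw'=a(aw\mathbin{\sqcup\!\sqcup}_\hbar w'+w\mathbin{\sqcup\!\sqcup}_\hbar aw'+\hbar\,w\mathbin{\sqcup\!\sqcup}_\hbar w')$, $bw\mathbin{\sqcup\!\sqcup}_\hbar w'=w\mathbin{\sqcup\!\sqcup}_\hbar bw'=b(w\mathbin{\sqcup\!\sqcup}_\hbar w')$, unit $1$; it preserves $\widehat{\mathfrak{H}}^1$, and $\widehat{\mathfrak{H}}^1$ is stable under left multiplication by $a$. For $w\in\widehat{\mathfrak{H}}^1$ let $u_m(w)$ be the coefficient of $t^m$ in $\mathcal{L}(w)$ and $z_n(w)=\sum_{m=1}^{n-1}u_m(w)$ (with $\hbar$ acting as $1-q$). Finally $\omega_n({\bf k};q)=\sum_{m_1+\cdots+m_r=n,\,m_a>0}\prod_a q^{(k_a-1)m_a}/[m_a]^{k_a}$; these are evaluated at $q=\zeta_n$. *)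

theory Defs
  imports
    Complex_Main
    "HOL-Library.Poly_Mapping"
    "HOL-Computational_Algebra.Formal_Power_Series"
begin

section \<open>The noncommutative polynomial algebra\<close>

text \<open>
  \<^typ>\<open>int \<Rightarrow>\<^sub>0 rat\<close> with its convolution product is the ring of Laurent polynomials
  over the rationals.  Noncommutative polynomials are the monoid algebra of the free monoid,
  written additively so that the convolution product of \<^theory>\<open>HOL-Library.Poly_Mapping\<close> applies.
\<close>

type_synonym laurent = "int \<Rightarrow>\<^sub>0 rat"

datatype 'x free_monoid = FM (letters: "'x list")

instantiation free_monoid :: (type) monoid_add
begin

definition zero_free_monoid :: "'a free_monoid" where
  "zero_free_monoid = FM []"

definition plus_free_monoid :: "'a free_monoid \<Rightarrow> 'a free_monoid \<Rightarrow> 'a free_monoid" where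
  "plus_free_monoid u v = FM (letters u @ letters v)"

instance
  by standard (simp_all add: zero_free_monoid_def plus_free_monoid_def)

end

type_synonym 'x ncpoly = "'x free_monoid \<Rightarrow>\<^sub>0 laurent"

definition hbar :: laurent where
  "hbar = Poly_Mapping.single 1 1"

definition scalar :: "laurent \<Rightarrow> 'x ncpoly" where
  "scalar c = Poly_Mapping.single 0 c"

definition gen :: "'x \<Rightarrow> 'x ncpoly" where
  "gen x = Poly_Mapping.single (FM [x]) 1"

definition lin_ext :: "('w \<Rightarrow> 'x ncpoly) \<Rightarrow> ('w \<Rightarrow>\<^sub>0 laurent) \<Rightarrow> 'x ncpoly" where
  "lin_ext g f = (\<Sum>w\<in>Poly_Mapping.keys f. scalar (Poly_Mapping.lookup f w) * g w)"

datatype letter = A | B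

abbreviation gen_a :: "letter ncpoly" where "gen_a \<equiv> gen A"
abbreviation gen_b :: "letter ncpoly" where "gen_b \<equiv> gen B"


section \<open>The subalgebra generated by the elements $e_k$\<close>

text \<open>
  Indices are \<^term>\<open>Num k\<close> with \<open>k \<ge> 1\<close>, and \<open>Hat1\<close>.  The value \<^term>\<open>Num 0\<close> is excluded
  through \<open>index_words\<close>.
\<close>

datatype index = Hat1 | Num nat

definition index_words :: "index list set" where
  "index_words = {ks. Num 0 \<notin> set ks}"

fun e_gen :: "index \<Rightarrow> letter ncpoly" where
  "e_gen Hat1 = gen_a * gen_b"
| "e_gen (Num k) = gen_a ^ (k - 1) * (gen_a + scalar hbar) * gen_b"

definition e_word :: "index list \<Rightarrow> letter ncpoly" where
  "e_word ks = prod_list (map e_gen ks)"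

definition H1hat :: "letter ncpoly set" where
  "H1hat = lin_ext e_word ` {f. Poly_Mapping.keys f \<subseteq> index_words}"

text \<open>
  Coordinates with respect to the monomials in the \<open>e\<^sub>k\<close>; their existence and uniqueness on
  \<open>H1hat\<close> is lemma \<open>e_coords\<close> below.
\<close>

definition e_coords :: "letter ncpoly \<Rightarrow> (index list \<Rightarrow>\<^sub>0 laurent)" where
  "e_coords w = (THE f. Poly_Mapping.keys f \<subseteq> index_words \<and> lin_ext e_word f = w)"


section \<open>The product on noncommutative polynomials\<close>

fun shuffle_words :: "letter list \<Rightarrow> letter list \<Rightarrow> letter ncpoly" where
  "shuffle_words [] v = Poly_Mapping.single (FM v) 1"
| "shuffle_words u [] = Poly_Mapping.single (FM u) 1"
| "shuffle_words (B # u) v = gen_b * shuffle_words u v"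
| "shuffle_words u (B # v) = gen_b * shuffle_words u v"
| "shuffle_words (A # u) (A # v) =
     gen_a * (shuffle_words (A # u) v + shuffle_words u (A # v) + scalar hbar * shuffle_words u v)"

definition shuffle :: "letter ncpoly \<Rightarrow> letter ncpoly \<Rightarrow> letter ncpoly"  (infixr \<open>\<squnion>\<squnion>\<close> 70) where
  "x \<squnion>\<squnion> y = lin_ext (\<lambda>u. lin_ext (\<lambda>v. shuffle_words (letters u) (letters v)) y) x"

definition shuffle_list :: "letter ncpoly list \<Rightarrow> letter ncpoly" where
  "shuffle_list ws = foldr shuffle ws 1"


section \<open>The q-series\<close>

text \<open>
  The parameter \<open>q\<close> is a complex number.  At a primitive \<open>n\<close>-th root of unity with \<open>n \<ge> 2\<close> the
  q-integers \<open>[m]\<close> with \<open>0 < m < n\<close> are nonzero, and only these enter \<open>z_sum q n\<close> and, for at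
  least two parts, \<open>omega n\<close>; for \<open>n = 1\<close> both are empty sums.
\<close>

definition qint :: "complex \<Rightarrow> nat \<Rightarrow> complex" where
  "qint q m = (1 - q ^ m) / (1 - q)"

fun F_term :: "complex \<Rightarrow> index \<Rightarrow> nat \<Rightarrow> complex" where
  "F_term q Hat1 m = q ^ m / qint q m"
| "F_term q (Num k) m = q ^ ((k - 1) * m) / qint q m ^ k"

text \<open>
  Tuples \<open>m\<^sub>1 > \<dots> > m\<^sub>r > 0\<close> with \<open>m\<^sub>1 = m\<close>.  For \<open>r = 0\<close> the empty tuple contributes to \<open>t\<^sup>0\<close>,
  so that the empty index has the series 1.
\<close>

definition decr_tuples :: "nat \<Rightarrow> nat \<Rightarrow> nat list set" where
  "decr_tuples r m = {ms. length ms = r \<and> sorted_wrt (>) ms \<and> (\<forall>x\<in>set ms. x > 0) \<and>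
     (case ms of [] \<Rightarrow> 0 | m1 # _ \<Rightarrow> m1) = m}"

definition L_series :: "complex \<Rightarrow> index list \<Rightarrow> complex fps" where
  "L_series q ks = Abs_fps (\<lambda>m. \<Sum>ms\<in>decr_tuples (length ks) m.
     \<Prod>i<length ks. F_term q (ks ! i) (ms ! i))"

definition eval_hbar :: "complex \<Rightarrow> laurent \<Rightarrow> complex" where
  "eval_hbar q c = (\<Sum>i\<in>Poly_Mapping.keys c. of_rat (Poly_Mapping.lookup c i) * (1 - q) powi i)"

definition L_map :: "complex \<Rightarrow> letter ncpoly \<Rightarrow> complex fps" where
  "L_map q w = (\<Sum>ks\<in>Poly_Mapping.keys (e_coords w).
     fps_const (eval_hbar q (Poly_Mapping.lookup (e_coords w) ks)) * L_series q ks)"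

definition u_coeff :: "complex \<Rightarrow> nat \<Rightarrow> letter ncpoly \<Rightarrow> complex" where
  "u_coeff q m w = fps_nth (L_map q w) m"

definition z_sum :: "complex \<Rightarrow> nat \<Rightarrow> letter ncpoly \<Rightarrow> complex" where
  "z_sum q n w = (\<Sum>m=1..<n. u_coeff q m w)"

definition compositions :: "nat \<Rightarrow> nat \<Rightarrow> nat list set" where
  "compositions r n = {ms. length ms = r \<and> (\<forall>x\<in>set ms. x > 0) \<and> sum_list ms = n}"

definition omega :: "nat \<Rightarrow> nat list \<Rightarrow> complex \<Rightarrow> complex" where
  "omega n ks q = (\<Sum>ms\<in>compositions (length ks) n.
     \<Prod>i<length ks. q ^ ((ks ! i - 1) * (ms ! i)) / qint q (ms ! i) ^ (ks ! i))"

definition primitive_root_of_unity :: "nat \<Rightarrow> complex \<Rightarrow> bool" where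
  "primitive_root_of_unity n \<zeta> \<longleftrightarrow> n > 0 \<and> \<zeta> ^ n = 1 \<and> (\<forall>m. 0 < m \<and> m < n \<longrightarrow> \<zeta> ^ m \<noteq> 1)"


section \<open>Well-definedness and basic properties\<close>

lemma scalar_add: "scalar (c + d) = scalar c + scalar d"
  by (simp add: scalar_def single_add)

lemma scalar_mult: "scalar (c * d) = scalar c * scalar d"
  by (simp add: scalar_def mult_single)

lemma scalar_1 [simp]: "scalar 1 = 1"
  by (simp add: scalar_def)

lemma scalar_0 [simp]: "scalar 0 = 0"
  by (simp add: scalar_def)

lemma scalar_times_single:
  "scalar c * Poly_Mapping.single w d = (Poly_Mapping.single w (c * d) :: 'x ncpoly)"
  by (simp add: scalar_def mult_single)

lemma single_times_scalar:
  "Poly_Mapping.single w d * scalar c = (Poly_Mapping.single w (c * d) :: 'x ncpoly)"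
  by (simp add: scalar_def mult_single mult.commute)

lemma sum_single_keys:
  "(\<Sum>w\<in>Poly_Mapping.keys f. Poly_Mapping.single w (Poly_Mapping.lookup f w)) = f"
proof (rule poly_mapping_eqI)
  fix k
  have "(\<Sum>w\<in>Poly_Mapping.keys f. Poly_Mapping.lookup
      (Poly_Mapping.single w (Poly_Mapping.lookup f w)) k)
    = (\<Sum>w\<in>Poly_Mapping.keys f. if w = k then Poly_Mapping.lookup f k else 0)"
    by (rule sum.cong) (auto simp: lookup_single when_def)
  then show "Poly_Mapping.lookup
      (\<Sum>w\<in>Poly_Mapping.keys f. Poly_Mapping.single w (Poly_Mapping.lookup f w)) k
    = Poly_Mapping.lookup f k"
    by (simp add: lookup_sum in_keys_iff)
qed

lemma poly_mapping_single_induct [case_names zero single add]: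
  fixes f :: "'w \<Rightarrow>\<^sub>0 'c::comm_monoid_add"
  assumes "P 0" "\<And>w c. P (Poly_Mapping.single w c)" "\<And>x y. P x \<Longrightarrow> P y \<Longrightarrow> P (x + y)"
  shows "P f"
proof -
  have "P (\<Sum>w\<in>S. Poly_Mapping.single w (Poly_Mapping.lookup f w))" for S
    by (induction S rule: infinite_finite_induct) (use assms in auto)
  then show ?thesis using sum_single_keys by metis
qed

lemma scalar_commute: "scalar c * x = x * scalar c"
  by (induction x rule: poly_mapping_single_induct)
     (simp_all add: scalar_times_single single_times_scalar distrib_left distrib_right)

lemma lin_ext_superset:
  assumes "finite S" "Poly_Mapping.keys f \<subseteq> S"
  shows "lin_ext g f = (\<Sum>w\<in>S. scalar (Poly_Mapping.lookup f w) * g w)"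
  unfolding lin_ext_def
  by (rule sum.mono_neutral_left) (use assms in \<open>auto simp: in_keys_iff\<close>)

lemma lin_ext_add: "lin_ext g (f1 + f2) = lin_ext g f1 + lin_ext g f2"
proof -
  let ?S = "Poly_Mapping.keys f1 \<union> Poly_Mapping.keys f2"
  show ?thesis
    using lin_ext_superset[of ?S f1 g] lin_ext_superset[of ?S f2 g]
      lin_ext_superset[of ?S "f1 + f2" g] keys_add[of f1 f2]
    by (simp add: lookup_add scalar_add distrib_right sum.distrib)
qed

lemma lin_ext_0 [simp]: "lin_ext g 0 = 0"
  by (simp add: lin_ext_def)

lemma lin_ext_single [simp]: "lin_ext g (Poly_Mapping.single w c) = scalar c * g w"
  by (cases "c = 0") (simp_all add: lin_ext_def)

lemma lin_ext_scale: "lin_ext g (scalar c * f) = scalar c * lin_ext g f"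
  by (induction f rule: poly_mapping_single_induct)
     (simp_all add: scalar_times_single scalar_mult mult.assoc lin_ext_add distrib_left)

lemma lin_ext_fun_add: "lin_ext (\<lambda>w. g w + h w) f = lin_ext g f + lin_ext h f"
  by (simp add: lin_ext_def distrib_left sum.distrib)

lemma lin_ext_fun_mult: "lin_ext (\<lambda>w. x * g w) f = x * lin_ext g f"
  unfolding lin_ext_def sum_distrib_left
  by (rule sum.cong) (simp, metis mult.assoc scalar_commute)

lemma single_FM_Cons:
  "Poly_Mapping.single (FM (x # w)) c = gen x * Poly_Mapping.single (FM w) c"
  by (simp add: gen_def mult_single plus_free_monoid_def)

lemma gen_power: "gen x ^ n = (Poly_Mapping.single (FM (replicate n x)) 1 :: 'x ncpoly)"
  by (induction n)
     (simp_all add: single_FM_Cons, simp flip: zero_free_monoid_def)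


subsection \<open>Freeness\<close>

text \<open>
  A left inverse of the evaluation map is built from \<open>ab = e\<^bsub>Hat1\<^esub>\<close>,
  \<open>b = hbar\<^sup>-\<^sup>1 (e\<^sub>1 - e\<^bsub>Hat1\<^esub>)\<close> and \<open>a\<^sup>k b = e\<^sub>k - hbar a\<^sup>k\<^sup>-\<^sup>1 b\<close> for \<open>k \<ge> 2\<close>.
\<close>

definition hbar_inv :: laurent where
  "hbar_inv = Poly_Mapping.single (- 1) 1"

lemma hbar_inv: "hbar * hbar_inv = 1"
  by (simp add: hbar_def hbar_inv_def mult_single)

fun block_coords :: "nat \<Rightarrow> index ncpoly" where
  "block_coords 0 = scalar hbar_inv * (gen (Num 1) - gen Hat1)"
| "block_coords (Suc 0) = gen Hat1"
| "block_coords (Suc (Suc n)) = gen (Num (Suc (Suc n))) - scalar hbar * block_coords (Suc n)"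

fun word_coords :: "nat \<Rightarrow> letter list \<Rightarrow> index ncpoly" where
  "word_coords n [] = 1"
| "word_coords n (A # w) = word_coords (Suc n) w"
| "word_coords n (B # w) = block_coords n * word_coords 0 w"

definition coords :: "letter ncpoly \<Rightarrow> index ncpoly" where
  "coords = lin_ext (\<lambda>w. word_coords 0 (letters w))"

lemma word_coords_block:
  "word_coords m (replicate n A @ B # w) = block_coords (m + n) * word_coords 0 w"
  by (induction n arbitrary: m) auto

lemma coords_block: "coords (gen_a ^ n * gen_b * x) = block_coords n * coords x"
proof (induction x rule: poly_mapping_single_induct)
  case (single w c)
  have "gen_a ^ n * gen_b * Poly_Mapping.single w c
      = Poly_Mapping.single (FM (replicate n A @ B # letters w)) c"
    unfolding gen_power by (simp add: gen_def mult_single plus_free_monoid_def)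
  moreover have "scalar c * (block_coords n * y) = block_coords n * (scalar c * y)" for y
    by (metis mult.assoc scalar_commute)
  ultimately show ?case
    by (simp add: coords_def word_coords_block)
qed (simp_all add: coords_def lin_ext_add distrib_left)

lemma coords_e_gen:
  assumes "k \<noteq> Num 0"
  shows "coords (e_gen k * x) = gen k * coords x"
proof (cases k)
  case Hat1
  then show ?thesis using coords_block[of 1 x] by simp
next
  case (Num m)
  with assms obtain p where p: "m = Suc p" by (cases m) auto
  have "e_gen k * x
      = gen_a ^ m * gen_b * x + scalar hbar * (gen_a ^ p * gen_b * x)"
    using scalar_commute[of hbar "gen_a ^ p"]
    by (simp add: Num p distrib_left distrib_right power_Suc2 del: power_Suc flip: mult.assoc)
  then have "coords (e_gen k * x)
      = (block_coords m + scalar hbar * block_coords p) * coords x"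
    by (simp add: coords_def lin_ext_add lin_ext_scale distrib_right mult.assoc
        coords_block[unfolded coords_def mult.assoc])
  also have "block_coords m + scalar hbar * block_coords p = gen k"
  proof (cases p)
    case 0
    have "scalar hbar * (scalar hbar_inv * y) = (y :: index ncpoly)" for y
      by (simp add: hbar_inv flip: mult.assoc scalar_mult)
    then show ?thesis by (simp add: 0 p Num)
  qed (simp add: p Num)
  finally show ?thesis .
qed

lemma coords_e_word:
  assumes "ks \<in> index_words"
  shows "coords (e_word ks) = Poly_Mapping.single (FM ks) 1"
  using assms
proof (induction ks)
  case Nil
  have "coords 1 = 1"
    using lin_ext_single[of "\<lambda>w. word_coords 0 (letters w)" 0 1]
    by (simp add: coords_def) (simp add: zero_free_monoid_def)
  then show ?case by (simp add: e_word_def flip: zero_free_monoid_def)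
next
  case (Cons k ks)
  then have "k \<noteq> Num 0" by (auto simp: index_words_def)
  with Cons show ?case
    by (simp add: e_word_def index_words_def coords_e_gen single_FM_Cons)
qed

lemma coords_lin_ext_e_word:
  assumes "Poly_Mapping.keys f \<subseteq> index_words"
  shows "Poly_Mapping.lookup (coords (lin_ext e_word f)) (FM ks) = Poly_Mapping.lookup f ks"
proof -
  have sum: "coords (sum g S) = (\<Sum>x\<in>S. coords (g x))" for g :: "index list \<Rightarrow> _" and S
    by (induction S rule: infinite_finite_induct) (simp_all add: coords_def lin_ext_add)
  have "coords (lin_ext e_word f)
      = (\<Sum>w\<in>Poly_Mapping.keys f. scalar (Poly_Mapping.lookup f w) * coords (e_word w))"
    unfolding lin_ext_def[of e_word] sum by (simp add: coords_def lin_ext_scale)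
  also have "\<dots> = (\<Sum>w\<in>Poly_Mapping.keys f. Poly_Mapping.single (FM w) (Poly_Mapping.lookup f w))"
    by (rule sum.cong) (use assms in \<open>auto simp: coords_e_word scalar_times_single\<close>)
  finally have "Poly_Mapping.lookup (coords (lin_ext e_word f)) (FM ks)
      = (\<Sum>w\<in>Poly_Mapping.keys f. if w = ks then Poly_Mapping.lookup f ks else 0)"
    by (simp add: lookup_sum lookup_single when_def cong: if_cong)
  then show ?thesis by (simp add: in_keys_iff)
qed

lemma inj_on_lin_ext_e_word:
  "inj_on (lin_ext e_word) {f. Poly_Mapping.keys f \<subseteq> index_words}"
  by (rule inj_onI, rule poly_mapping_eqI) (metis coords_lin_ext_e_word mem_Collect_eq)

lemma e_coords_unique:
  assumes "Poly_Mapping.keys f \<subseteq> index_words"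
  shows "e_coords (lin_ext e_word f) = f"
  unfolding e_coords_def
  by (rule the_equality) (use assms inj_on_lin_ext_e_word in \<open>auto dest: inj_onD\<close>)

lemma e_coords:
  assumes "w \<in> H1hat"
  shows "Poly_Mapping.keys (e_coords w) \<subseteq> index_words" "lin_ext e_word (e_coords w) = w"
  using assms e_coords_unique by (auto simp: H1hat_def)

lemma e_word_in_H1hat: "ks \<in> index_words \<Longrightarrow> e_word ks \<in> H1hat"
  unfolding H1hat_def
  by (rule image_eqI[of _ _ "Poly_Mapping.single ks 1"]) auto

lemma e_coords_e_word: "ks \<in> index_words \<Longrightarrow> e_coords (e_word ks) = Poly_Mapping.single ks 1"
  using e_coords_unique[of "Poly_Mapping.single ks 1"] by simp

lemma L_map_e_word:
  assumes "ks \<in> index_words"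
  shows "L_map q (e_word ks) = L_series q ks"
  by (simp add: L_map_def e_coords_e_word[OF assms] eval_hbar_def)


subsection \<open>Evaluation of scalars and linearity\<close>

lemma eval_hbar_superset:
  assumes "finite S" "Poly_Mapping.keys c \<subseteq> S"
  shows "eval_hbar q c = (\<Sum>i\<in>S. of_rat (Poly_Mapping.lookup c i) * (1 - q) powi i)"
  unfolding eval_hbar_def
  by (rule sum.mono_neutral_left) (use assms in \<open>auto simp: in_keys_iff\<close>)

lemma eval_hbar_add: "eval_hbar q (c + d) = eval_hbar q c + eval_hbar q d"
proof -
  let ?S = "Poly_Mapping.keys c \<union> Poly_Mapping.keys d"
  show ?thesis
    using eval_hbar_superset[of ?S c q] eval_hbar_superset[of ?S d q]
      eval_hbar_superset[of ?S "c + d" q] keys_add[of c d]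
    by (simp add: lookup_add of_rat_add distrib_right sum.distrib)
qed

lemma eval_hbar_0 [simp]: "eval_hbar q 0 = 0"
  by (simp add: eval_hbar_def)

lemma eval_hbar_single [simp]:
  "eval_hbar q (Poly_Mapping.single i x) = of_rat x * (1 - q) powi i"
  by (cases "x = 0") (simp_all add: eval_hbar_def)

lemma eval_hbar_hbar [simp]: "eval_hbar q hbar = 1 - q"
  by (simp add: hbar_def)

lemma eval_hbar_mult:
  assumes "q \<noteq> 1"
  shows "eval_hbar q (c * d) = eval_hbar q c * eval_hbar q d"
proof (induction c rule: poly_mapping_single_induct)
  case (single i x)
  show ?case
    by (induction d rule: poly_mapping_single_induct)
       (use assms in \<open>simp_all add: mult_single of_rat_mult power_int_add eval_hbar_add distrib_left\<close>)
qed (simp_all add: eval_hbar_add distrib_right)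

lemma L_map_lin_ext:
  assumes "finite S" "Poly_Mapping.keys f \<subseteq> S" "Poly_Mapping.keys f \<subseteq> index_words"
  shows "L_map q (lin_ext e_word f)
    = (\<Sum>ks\<in>S. fps_const (eval_hbar q (Poly_Mapping.lookup f ks)) * L_series q ks)"
  unfolding L_map_def e_coords_unique[OF assms(3)]
  by (rule sum.mono_neutral_left) (use assms in \<open>auto simp: in_keys_iff\<close>)

lemma L_map_add:
  assumes "w \<in> H1hat" "w' \<in> H1hat"
  shows "L_map q (w + w') = L_map q w + L_map q w'"
proof -
  obtain f g where f: "w = lin_ext e_word f" "Poly_Mapping.keys f \<subseteq> index_words"
    and g: "w' = lin_ext e_word g" "Poly_Mapping.keys g \<subseteq> index_words"
    using assms by (auto simp: H1hat_def)
  let ?S = "Poly_Mapping.keys f \<union> Poly_Mapping.keys g"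
  have k: "Poly_Mapping.keys (f + g) \<subseteq> ?S" by (rule keys_add)
  with f g have k': "Poly_Mapping.keys (f + g) \<subseteq> index_words" by blast
  show ?thesis
    unfolding f(1) g(1) lin_ext_add[symmetric]
    using L_map_lin_ext[of ?S f q] L_map_lin_ext[of ?S g q] L_map_lin_ext[of ?S "f + g" q] k k' f g
    by (simp add: lookup_add eval_hbar_add distrib_right sum.distrib flip: fps_const_add)
qed

lemma L_map_scale:
  assumes "w \<in> H1hat" "q \<noteq> 1"
  shows "L_map q (scalar c * w) = fps_const (eval_hbar q c) * L_map q w"
proof -
  obtain f where f: "w = lin_ext e_word f" "Poly_Mapping.keys f \<subseteq> index_words"
    using assms by (auto simp: H1hat_def)
  define cf where "cf = Poly_Mapping.map ((*) c) f"
  have lookup: "Poly_Mapping.lookup cf ks = c * Poly_Mapping.lookup f ks" for ks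
    by (simp add: cf_def Poly_Mapping.map.rep_eq when_def)
  then have keys: "Poly_Mapping.keys cf \<subseteq> Poly_Mapping.keys f"
    by (auto simp: in_keys_iff)
  have "scalar c * w = lin_ext e_word cf"
    unfolding f(1) lin_ext_superset[OF finite_keys keys] lin_ext_def[of e_word f]
    by (simp add: lookup scalar_mult sum_distrib_left mult.assoc)
  then show ?thesis
    using L_map_lin_ext[OF finite_keys keys] L_map_lin_ext[OF finite_keys order_refl f(2)] keys f
    by (simp add: lookup eval_hbar_mult assms(2) sum_distrib_left mult.assoc flip: fps_const_mult)
qed


subsection \<open>Defining equations of the product\<close>

lemma shuffle_words_Nil2 [simp]: "shuffle_words w [] = Poly_Mapping.single (FM w) 1"
  by (cases w) auto

lemma shuffle_words_B1: "shuffle_words (B # w) w' = gen_b * shuffle_words w w'"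
  by (cases w') (simp_all add: single_FM_Cons)

lemma shuffle_words_B2: "shuffle_words w (B # w') = gen_b * shuffle_words w w'"
proof (induction w)
  case (Cons x w)
  then show ?case by (cases x; cases w') (simp_all add: shuffle_words_B1 single_FM_Cons)
qed (simp add: single_FM_Cons)

lemma shuffle_add_left: "(x + y) \<squnion>\<squnion> w = x \<squnion>\<squnion> w + y \<squnion>\<squnion> w"
  by (simp add: shuffle_def lin_ext_add)

lemma shuffle_add_right: "w \<squnion>\<squnion> (x + y) = w \<squnion>\<squnion> x + w \<squnion>\<squnion> y"
  by (simp add: shuffle_def lin_ext_add lin_ext_fun_add)

lemma shuffle_scale_left: "(scalar c * x) \<squnion>\<squnion> w = scalar c * (x \<squnion>\<squnion> w)"
  by (simp add: shuffle_def lin_ext_scale)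

lemma shuffle_scale_right: "w \<squnion>\<squnion> (scalar c * x) = scalar c * (w \<squnion>\<squnion> x)"
  by (simp add: shuffle_def lin_ext_scale lin_ext_fun_mult)

lemma shuffle_0 [simp]: "0 \<squnion>\<squnion> w = 0" "w \<squnion>\<squnion> 0 = 0"
  by (simp_all add: shuffle_def) (simp add: lin_ext_def)

lemma shuffle_single:
  "Poly_Mapping.single v c \<squnion>\<squnion> Poly_Mapping.single w d
   = scalar (c * d) * shuffle_words (letters v) (letters w)"
  by (simp add: shuffle_def scalar_mult mult.assoc)

lemma gen_times_single:
  "gen x * Poly_Mapping.single w c = Poly_Mapping.single (FM (x # letters w)) c"
  by (simp add: gen_def mult_single plus_free_monoid_def)

lemma gen_scalar_swap: "gen x * (scalar c * y) = scalar c * (gen x * y)"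
  by (metis mult.assoc scalar_commute)

lemma shuffle_1_left: "1 \<squnion>\<squnion> w = w"
proof (induction w rule: poly_mapping_single_induct)
  case (single w c)
  show ?case
    using shuffle_single[of 0 1 w c]
    by (simp add: scalar_times_single) (simp add: zero_free_monoid_def scalar_times_single)
qed (simp_all add: shuffle_add_right)

lemma shuffle_1_right: "w \<squnion>\<squnion> 1 = w"
proof (induction w rule: poly_mapping_single_induct)
  case (single w c)
  show ?case
    using shuffle_single[of w c 0 1]
    by (simp add: scalar_times_single) (simp add: zero_free_monoid_def scalar_times_single)
qed (simp_all add: shuffle_add_left)

lemma shuffle_b_left: "(gen_b * w) \<squnion>\<squnion> w' = gen_b * (w \<squnion>\<squnion> w')"
proof (induction w rule: poly_mapping_single_induct)
  case (single v c)
  show ?case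
    by (induction w' rule: poly_mapping_single_induct)
       (simp_all add: gen_times_single shuffle_single shuffle_words_B1 gen_scalar_swap
          shuffle_add_right distrib_left)
qed (simp_all add: shuffle_add_left distrib_left)

lemma shuffle_b_right: "w \<squnion>\<squnion> (gen_b * w') = gen_b * (w \<squnion>\<squnion> w')"
proof (induction w rule: poly_mapping_single_induct)
  case (single v c)
  show ?case
    by (induction w' rule: poly_mapping_single_induct)
       (simp_all add: gen_times_single shuffle_single shuffle_words_B2 gen_scalar_swap
          shuffle_add_right distrib_left)
qed (simp_all add: shuffle_add_left distrib_left)

lemma shuffle_a_a:
  "(gen_a * w) \<squnion>\<squnion> (gen_a * w')
   = gen_a * ((gen_a * w) \<squnion>\<squnion> w' + w \<squnion>\<squnion> (gen_a * w') + scalar hbar * (w \<squnion>\<squnion> w'))"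
proof (induction w rule: poly_mapping_single_induct)
  case (single v c)
  show ?case
  proof (induction w' rule: poly_mapping_single_induct)
    case (single w d)
    have swap: "scalar hbar * (scalar (c * d) * y) = scalar (c * d) * (scalar hbar * y)" for y
      by (metis mult.assoc scalar_commute)
    show ?case
      by (simp add: gen_times_single shuffle_single gen_scalar_swap swap distrib_left)
  qed (simp_all add: shuffle_add_right distrib_left add_ac)
qed (simp_all add: shuffle_add_left distrib_left add_ac)


subsection \<open>Finiteness of the index sets\<close>

lemma finite_decr_tuples: "finite (decr_tuples r m)"
proof (rule finite_subset)
  show "decr_tuples r m \<subseteq> {ms. set ms \<subseteq> {..m} \<and> length ms = r}"
  proof
    fix ms assume "ms \<in> decr_tuples r m"
    then show "ms \<in> {ms. set ms \<subseteq> {..m} \<and> length ms = r}"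
      by (cases ms) (auto simp: decr_tuples_def)
  qed
  show "finite {ms. set ms \<subseteq> {..m} \<and> length ms = r}"
    by (rule finite_lists_length_eq) simp
qed

lemma finite_compositions: "finite (compositions r n)"
proof (rule finite_subset)
  show "compositions r n \<subseteq> {ms. set ms \<subseteq> {..n} \<and> length ms = r}"
    by (auto simp: compositions_def dest: member_le_sum_list)
  show "finite {ms. set ms \<subseteq> {..n} \<and> length ms = r}"
    by (rule finite_lists_length_eq) simp
qed

end

theory Submission
  imports Defs
begin

text \<open>
  On coefficients of \<open>t\<^sup>m\<close>, the letter \<open>a\<close> acts as multiplication by \<open>c\<^sub>m = q\<^sup>m / [m]\<close> and \<open>b\<close> as
  summation over all smaller exponents, that is, as multiplication of series by \<open>t / (1 - t)\<close>.
  The identity \<open>c\<^sub>i c\<^sub>j = c\<^bsub>i+j\<^esub> (c\<^sub>i + c\<^sub>j + (1 - q))\<close> makes this action turn the product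
  \<open>\<squnion>\<squnion>\<close> into the product of power series, up to the first exponent where \<open>q\<^sup>m = 1\<close>.
  The coefficients of the series of \<open>e\<^bsub>k\<^sub>1\<^esub> \<squnion>\<squnion> \<dots> \<squnion>\<squnion> e\<^bsub>k\<^bsub>r-1\<^esub>\<^esub>\<close> are thus the sums over
  compositions into \<open>r - 1\<close> parts. Since \<open>c\<^sub>m + (1 - q) = 1 / [m]\<close>, the binomial theorem collapses
  the sum over \<open>j\<close> to the factor \<open>q\<^sup>m / [m]\<^sup>k\<close>, which at a primitive root of unity is
  \<open>(-1)\<^sup>k F\<^sub>k(n - m)\<close> because \<open>[n - m] = - q\<^sup>-\<^sup>m [m]\<close>.
\<close>

section \<open>The action of words on power series\<close>

definition a_factor :: "complex \<Rightarrow> nat \<Rightarrow> complex" where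
  "a_factor q m = q ^ m / qint q m"

definition a_op :: "complex \<Rightarrow> complex fps \<Rightarrow> complex fps" where
  "a_op q s = Abs_fps (\<lambda>m. a_factor q m * fps_nth s m)"

definition b_op :: "complex fps \<Rightarrow> complex fps" where
  "b_op s = Abs_fps (\<lambda>m. \<Sum>i<m. fps_nth s i)"

fun word_series :: "complex \<Rightarrow> letter list \<Rightarrow> complex fps" where
  "word_series q [] = 1"
| "word_series q (A # w) = a_op q (word_series q w)"
| "word_series q (B # w) = b_op (word_series q w)"

text \<open>Computed letter by letter on the word basis, so that left multiplication by a or b is
  visible directly; \<open>L_map\<close> needs coordinates in the e_k instead. The two are compared
  in \<open>u_coeff_eq_nc_series\<close>.\<close>

definition nc_series :: "complex \<Rightarrow> letter ncpoly \<Rightarrow> complex fps" where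
  "nc_series q f = (\<Sum>w\<in>Poly_Mapping.keys f.
     fps_const (eval_hbar q (Poly_Mapping.lookup f w)) * word_series q (letters w))"

text \<open>Here [0] = 0, so the convention for division by zero gives 0. Thus a kills constant
  terms.\<close>

lemma a_factor_0 [simp]: "a_factor q 0 = 0"
  by (simp add: a_factor_def qint_def)

lemma a_op_nth [simp]: "fps_nth (a_op q s) m = a_factor q m * fps_nth s m"
  by (simp add: a_op_def)

lemma b_op_nth [simp]: "fps_nth (b_op s) m = (\<Sum>i<m. fps_nth s i)"
  by (simp add: b_op_def)

lemma a_op_add: "a_op q (s + t) = a_op q s + a_op q t"
  by (rule fps_ext) (simp add: distrib_left)

lemma b_op_add: "b_op (s + t) = b_op s + b_op t"
  by (rule fps_ext) (simp add: sum.distrib)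

lemma a_op_const: "a_op q (fps_const c * s) = fps_const c * a_op q s"
  by (rule fps_ext) simp

lemma b_op_const: "b_op (fps_const c * s) = fps_const c * b_op s"
  by (rule fps_ext) (simp add: sum_distrib_left)

lemma a_op_0 [simp]: "a_op q 0 = 0"
  by (rule fps_ext) simp

lemma b_op_0 [simp]: "b_op 0 = 0"
  by (rule fps_ext) simp

text \<open>Multiplication by a fixed series can be pulled out of either factor of a product, which
  is the series counterpart of the rule for b in the shuffle product.\<close>

lemma b_op_eq_mult: "b_op s = (fps_X * Abs_fps (\<lambda>_. 1)) * s"
proof (rule fps_ext)
  fix m
  show "fps_nth (b_op s) m = fps_nth ((fps_X * Abs_fps (\<lambda>_. 1)) * s) m"
  proof (cases m)
    case (Suc p)
    have "fps_nth (Abs_fps (\<lambda>_. 1) * s) p = (\<Sum>i=0..p. fps_nth s i)"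
      by (subst mult.commute) (simp add: fps_mult_nth)
    then show ?thesis
      by (simp add: Suc mult.assoc lessThan_Suc_atMost atLeast0AtMost)
  qed (simp add: mult.assoc)
qed

lemma b_op_mult_left: "b_op s * t = b_op (s * t)"
  by (simp add: b_op_eq_mult mult.assoc)

lemma b_op_mult_right: "s * b_op t = b_op (s * t)"
  by (simp add: b_op_eq_mult mult_ac)

section \<open>Linear extension of the action to noncommutative polynomials\<close>

lemma nc_series_superset:
  assumes "finite S" "Poly_Mapping.keys f \<subseteq> S"
  shows "nc_series q f = (\<Sum>w\<in>S.
     fps_const (eval_hbar q (Poly_Mapping.lookup f w)) * word_series q (letters w))"
  unfolding nc_series_def
  by (rule sum.mono_neutral_left) (use assms in \<open>auto simp: in_keys_iff\<close>)

lemma nc_series_add: "nc_series q (f + g) = nc_series q f + nc_series q g"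
proof -
  let ?S = "Poly_Mapping.keys f \<union> Poly_Mapping.keys g"
  show ?thesis
    using nc_series_superset[of ?S f q] nc_series_superset[of ?S g q]
      nc_series_superset[of ?S "f + g" q] keys_add[of f g]
    by (simp add: lookup_add eval_hbar_add distrib_right sum.distrib flip: fps_const_add)
qed

lemma nc_series_0 [simp]: "nc_series q 0 = 0"
  by (simp add: nc_series_def)

lemma nc_series_single:
  "nc_series q (Poly_Mapping.single w c) = fps_const (eval_hbar q c) * word_series q (letters w)"
  by (cases "c = 0") (simp_all add: nc_series_def)

lemma eval_hbar_1 [simp]: "eval_hbar q 1 = 1"
  using eval_hbar_single[of q 0 1] by simp

lemma nc_series_1 [simp]: "nc_series q 1 = 1"
  using nc_series_single[of q 0 1] by simp (simp add: zero_free_monoid_def)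

lemma nc_series_scale:
  assumes "q \<noteq> 1"
  shows "nc_series q (scalar c * f) = fps_const (eval_hbar q c) * nc_series q f"
  by (induction f rule: poly_mapping_single_induct)
     (simp_all add: scalar_times_single nc_series_single nc_series_add distrib_left
        eval_hbar_mult[OF assms] mult.assoc flip: fps_const_mult)

lemma nc_series_sum: "nc_series q (sum g S) = (\<Sum>x\<in>S. nc_series q (g x))"
  by (induction S rule: infinite_finite_induct) (simp_all add: nc_series_add)

lemma nc_series_a: "nc_series q (gen_a * f) = a_op q (nc_series q f)"
  by (induction f rule: poly_mapping_single_induct)
     (simp_all add: gen_times_single nc_series_single nc_series_add distrib_left a_op_add a_op_const)

lemma nc_series_b: "nc_series q (gen_b * f) = b_op (nc_series q f)"
  by (induction f rule: poly_mapping_single_induct)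
     (simp_all add: gen_times_single nc_series_single nc_series_add distrib_left b_op_add b_op_const)

lemma nc_series_a_power:
  "fps_nth (nc_series q (gen_a ^ j * f)) m = a_factor q m ^ j * fps_nth (nc_series q f) m"
  by (induction j) (simp_all add: mult.assoc nc_series_a)

lemma word_series_nth_0: "w \<noteq> [] \<Longrightarrow> fps_nth (word_series q w) 0 = 0"
  by (induction q w rule: word_series.induct) auto

section \<open>The left ideal of words ending in \<open>b\<close>\<close>

text \<open>The domain on which the action turns shuffles into products of series. A trailing a
  breaks this: a acts on 1 as 0, yet the shuffle of a with ab has in general a nonzero
  series.\<close>

definition Hb :: "letter ncpoly set" where
  "Hb = range (\<lambda>x. x * gen_b)"

lemma mult_gen_b_in_Hb: "x * gen_b \<in> Hb"
  by (simp add: Hb_def)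

lemma Hb_mult_left: "x \<in> Hb \<Longrightarrow> y * x \<in> Hb"
  by (auto simp: Hb_def simp flip: mult.assoc)

lemma Hb_add: "x \<in> Hb \<Longrightarrow> y \<in> Hb \<Longrightarrow> x + y \<in> Hb"
  by (auto simp: Hb_def simp flip: distrib_right)

lemma Hb_0: "0 \<in> Hb"
  using mult_gen_b_in_Hb[of 0] by simp

lemma single_mult_gen_b:
  "Poly_Mapping.single w c * gen_b = Poly_Mapping.single (FM (letters w @ [B])) c"
  by (simp add: gen_def mult_single plus_free_monoid_def)

lemma single_in_Hb: "w \<noteq> [] \<Longrightarrow> last w = B \<Longrightarrow> Poly_Mapping.single (FM w) c \<in> Hb"
  using mult_gen_b_in_Hb[of "Poly_Mapping.single (FM (butlast w)) c"]
  by (metis append_butlast_last_id free_monoid.sel single_mult_gen_b)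

lemma e_gen_in_Hb: "e_gen k \<in> Hb"
  by (cases k) (simp_all add: mult_gen_b_in_Hb)

text \<open>Each recursive rule strips leading letters and multiplies on the left. A final b is lost
  only when the stripped word is b itself, and then the other word is nonempty.\<close>

lemma shuffle_words_in_Hb:
  assumes "u = [] \<or> last u = B" "v = [] \<or> last v = B" "u \<noteq> [] \<or> v \<noteq> []"
  shows "shuffle_words u v \<in> Hb"
  using assms
proof (induction u v rule: shuffle_words.induct)
  case (3 u v)
  then show ?case
    by (auto intro!: Hb_mult_left split: if_splits)
next
  case (4 u v)
  then show ?case
    by (auto intro!: Hb_mult_left split: if_splits)
next
  case (5 u v)
  then show ?case
    by (auto intro!: Hb_mult_left Hb_add split: if_splits)
qed (auto intro: single_in_Hb)

lemma shuffle_in_Hb: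
  assumes "x \<in> Hb" "y \<in> Hb"
  shows "x \<squnion>\<squnion> y \<in> Hb"
proof -
  have "(x * gen_b) \<squnion>\<squnion> (y * gen_b) \<in> Hb" for x y
  proof (induction x rule: poly_mapping_single_induct)
    case (single u c)
    show ?case
      by (induction y rule: poly_mapping_single_induct)
         (auto simp: single_mult_gen_b shuffle_single distrib_right shuffle_add_right Hb_0
            intro!: Hb_mult_left Hb_add shuffle_words_in_Hb)
  qed (auto simp: distrib_right shuffle_add_left Hb_0 intro: Hb_add)
  with assms show ?thesis by (auto simp: Hb_def)
qed

lemma shuffle_list_in_Hb:
  assumes "ks \<noteq> []"
  shows "shuffle_list (map e_gen ks) \<in> Hb"
  using assms
  by (induction ks rule: list_nonempty_induct)
     (auto simp: shuffle_list_def shuffle_1_right e_gen_in_Hb intro: shuffle_in_Hb)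

section \<open>Words ending in b lie in the subalgebra generated by the e_k\<close>

lemma H1hat_scalar_e_word: "ks \<in> index_words \<Longrightarrow> scalar c * e_word ks \<in> H1hat"
  unfolding H1hat_def
  by (rule image_eqI[of _ _ "Poly_Mapping.single ks c"]) auto

lemma H1hat_add:
  assumes "x \<in> H1hat" "y \<in> H1hat"
  shows "x + y \<in> H1hat"
proof -
  obtain f g where "x = lin_ext e_word f" "Poly_Mapping.keys f \<subseteq> index_words"
    "y = lin_ext e_word g" "Poly_Mapping.keys g \<subseteq> index_words"
    using assms by (auto simp: H1hat_def)
  then show ?thesis
    unfolding H1hat_def using keys_add[of f g]
    by (intro image_eqI[of _ _ "f + g"]) (auto simp: lin_ext_add)
qed

lemma H1hat_0: "0 \<in> H1hat"
  using H1hat_scalar_e_word[of "[]" 0] by (simp add: index_words_def)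

lemma H1hat_sum: "(\<And>i. i \<in> S \<Longrightarrow> g i \<in> H1hat) \<Longrightarrow> sum g S \<in> H1hat"
  by (induction S rule: infinite_finite_induct) (auto intro: H1hat_add H1hat_0)

lemma H1hat_expand:
  assumes "x \<in> H1hat"
  obtains f where "Poly_Mapping.keys f \<subseteq> index_words"
    "x = (\<Sum>w\<in>Poly_Mapping.keys f. scalar (Poly_Mapping.lookup f w) * e_word w)"
  using assms by (auto simp: H1hat_def lin_ext_def)

lemma H1hat_scale:
  assumes "x \<in> H1hat"
  shows "scalar c * x \<in> H1hat"
  using assms
  by (elim H1hat_expand)
     (auto simp: sum_distrib_left simp flip: mult.assoc scalar_mult
       intro!: H1hat_sum H1hat_scalar_e_word)

lemma H1hat_e_gen:
  assumes "x \<in> H1hat" "k \<noteq> Num 0"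
  shows "e_gen k * x \<in> H1hat"
proof -
  have *: "e_gen k * (scalar c * e_word w) = scalar c * e_word (k # w)" for c w
    by (simp add: e_word_def) (metis mult.assoc scalar_commute)
  have "k # w \<in> index_words" if "w \<in> index_words" for w
    using that assms(2) by (auto simp: index_words_def)
  with assms(1) show ?thesis
    by (elim H1hat_expand)
       (auto simp: sum_distrib_left * intro!: H1hat_sum H1hat_scalar_e_word)
qed

lemma scalar_uminus: "scalar (- c) = - scalar c"
  by (simp add: scalar_def single_uminus)

text \<open>The relations behind \<open>block_coords\<close>, applied as left multiplications, so
  the induction follows the same three cases. The first one uses that hbar is invertible.\<close>

lemma H1hat_block:
  assumes "x \<in> H1hat"
  shows "gen_a ^ n * (gen_b * x) \<in> H1hat"
proof (induction n rule: block_coords.induct)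
  case 1
  have "e_gen (Num 1) * x + scalar (- 1) * (e_gen Hat1 * x) = scalar hbar * (gen_b * x)"
    by (simp add: distrib_right mult.assoc scalar_uminus)
  then have "scalar hbar * (gen_b * x) \<in> H1hat"
    using H1hat_add[OF H1hat_e_gen[OF assms, of "Num 1"]
        H1hat_scale[OF H1hat_e_gen[OF assms, of Hat1], of "- 1"]] by simp
  from H1hat_scale[OF this, of hbar_inv]
  have "scalar (hbar * hbar_inv) * (gen_b * x) \<in> H1hat"
    by (simp add: scalar_mult scalar_commute[of hbar "scalar hbar_inv"] mult.assoc)
  then show ?case by (simp add: hbar_inv)
next
  case 2
  show ?case using H1hat_e_gen[OF assms, of Hat1] by (simp add: mult.assoc)
next
  case (3 n)
  have "gen_a ^ Suc (Suc n) * (gen_b * x)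
      = e_gen (Num (Suc (Suc n))) * x + scalar (- hbar) * (gen_a ^ Suc n * (gen_b * x))"
    using scalar_commute[of hbar "gen_a ^ Suc n"]
    by (simp add: distrib_left distrib_right power_Suc2 scalar_uminus
        del: power_Suc flip: mult.assoc)
  then show ?case
    using H1hat_add[OF H1hat_e_gen[OF assms, of "Num (Suc (Suc n))"]
        H1hat_scale[OF 3, of "- hbar"]] by simp
qed

lemma Hb_subset_H1hat: "Hb \<subseteq> H1hat"
proof -
  have one: "1 \<in> H1hat"
    using e_word_in_H1hat[of "[]"] by (simp add: index_words_def e_word_def)
  \<comment> \<open>The power of a in front collects leading letters a until the next b completes a
    block, to which \<open>H1hat_block\<close> applies.\<close>
  have word: "gen_a ^ n * Poly_Mapping.single (FM (w @ [B])) 1 \<in> H1hat" for n w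
  proof (induction w arbitrary: n)
    case Nil
    show ?case using H1hat_block[OF one, of n] by (simp add: gen_def)
  next
    case (Cons x w)
    show ?case
    proof (cases x)
      case A
      then show ?thesis using Cons[of "Suc n"]
        by (simp add: single_FM_Cons power_Suc2 mult.assoc del: power_Suc)
    next
      case B
      then show ?thesis using H1hat_block[OF Cons[of 0], of n]
        by (simp add: single_FM_Cons)
    qed
  qed
  have "x * gen_b \<in> H1hat" for x
  proof (induction x rule: poly_mapping_single_induct)
    case (single w c)
    show ?case
      using H1hat_scale[OF word[of 0 "letters w"], of c]
      by (simp add: single_mult_gen_b scalar_times_single)
  qed (simp_all add: distrib_right H1hat_0 H1hat_add)
  then show ?thesis by (auto simp: Hb_def)
qed

section \<open>Coefficients below the order of \<open>q\<close>\<close>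

text \<open>The index \<open>i\<close> is the second largest entry. For \<open>r = 0\<close> the
  empty tuple sits at \<open>i = 0\<close>, so that \<open>i < m\<close> still says that m is
  positive.\<close>

lemma decr_tuples_Suc:
  "decr_tuples (Suc r) m = (\<Union>i<m. (#) m ` decr_tuples r i)"
proof (intro equalityI subsetI)
  fix ms assume "ms \<in> decr_tuples (Suc r) m"
  then obtain ms' where ms: "ms = m # ms'" "length ms' = r" "sorted_wrt (>) ms'"
    "\<forall>x\<in>set ms'. x > 0 \<and> x < m" "m > 0"
    by (auto simp: decr_tuples_def length_Suc_conv)
  then have "ms' \<in> decr_tuples r (case ms' of [] \<Rightarrow> 0 | x # _ \<Rightarrow> x)"
    "(case ms' of [] \<Rightarrow> 0 | x # _ \<Rightarrow> x) < m"
    by (auto simp: decr_tuples_def split: list.split)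
  with ms(1) show "ms \<in> (\<Union>i<m. (#) m ` decr_tuples r i)" by blast
next
  fix ms assume "ms \<in> (\<Union>i<m. (#) m ` decr_tuples r i)"
  then obtain i ms' where ms: "i < m" "ms = m # ms'" "ms' \<in> decr_tuples r i" by auto
  then have "x < m" if "x \<in> set ms'" for x
    using that by (cases ms') (auto simp: decr_tuples_def)
  with ms show "ms \<in> decr_tuples (Suc r) m"
    by (auto simp: decr_tuples_def)
qed

lemma L_series_Nil: "L_series q [] = 1"
  by (rule fps_ext) (auto simp: L_series_def decr_tuples_def cong: conj_cong)

text \<open>The recursion shared with \<open>nc_series_e_gen_nth\<close>: b sums over smaller
  exponents, and the remaining factor of e_k multiplies by F_k.\<close>

lemma L_series_Cons_nth:
  "fps_nth (L_series q (k # ks)) m = F_term q k m * (\<Sum>i<m. fps_nth (L_series q ks) i)"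
proof -
  have disj: "(#) m ` decr_tuples r i \<inter> (#) m ` decr_tuples r j = {}" if "i \<noteq> j" for r i j
    using that by (auto simp: decr_tuples_def)
  have "fps_nth (L_series q (k # ks)) m
      = (\<Sum>i<m. \<Sum>ms\<in>(#) m ` decr_tuples (length ks) i.
          \<Prod>l<Suc (length ks). F_term q ((k # ks) ! l) (ms ! l))"
    unfolding L_series_def
    by (simp add: decr_tuples_Suc, subst sum.UNION_disjoint)
       (use disj in \<open>auto simp: finite_decr_tuples\<close>)
  also have "\<dots> = (\<Sum>i<m. F_term q k m * fps_nth (L_series q ks) i)"
    by (rule sum.cong)
       (simp_all add: sum.reindex prod.lessThan_Suc_shift L_series_def sum_distrib_left
          del: prod.lessThan_Suc)
  finally show ?thesis by (simp add: sum_distrib_left)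
qed

text \<open>The assumptions make [m] nonzero for 0 < m < n, and hbar acts as the nonzero number 1 -
  q. The relation q^n = 1 enters only through \<open>F_term_reflect\<close>.\<close>

locale q_order_at_least =
  fixes q :: complex and n :: nat
  assumes q_neq_1: "q \<noteq> 1"
    and q_power_neq_1: "0 < m \<Longrightarrow> m < n \<Longrightarrow> q ^ m \<noteq> 1"
begin

lemma a_factor_plus_hbar:
  assumes "0 < m" "m < n"
  shows "a_factor q m + (1 - q) = 1 / qint q m"
  using q_power_neq_1[OF assms] q_neq_1
  by (simp add: a_factor_def qint_def field_simps)

lemma a_factor_mult:
  assumes "0 < i" "0 < j" "i + j < n"
  shows "a_factor q i * a_factor q j
    = a_factor q (i + j) * (a_factor q i + a_factor q j + (1 - q))"
proof -
  \<comment> \<open>Here x = q^i, y = q^j and h = 1 - q. The bracket has numerator h (1 - x y),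
    which cancels the denominator of c_(i+j).\<close>
  have *: "x / ((1 - x) / h) * (y / ((1 - y) / h))
      = x * y / ((1 - x * y) / h) * (x / ((1 - x) / h) + y / ((1 - y) / h) + h)"
    if "1 - x \<noteq> 0" "1 - y \<noteq> 0" "1 - x * y \<noteq> 0" "h \<noteq> 0" for x y h :: complex
  proof -
    have "x / ((1 - x) / h) + y / ((1 - y) / h) + h = h * (1 - x * y) / ((1 - x) * (1 - y))"
      using that by (simp add: divide_simps) (simp add: algebra_simps)
    then show ?thesis using that by simp
  qed
  show ?thesis
    unfolding a_factor_def qint_def power_add
    by (rule *) (use q_power_neq_1[of i] q_power_neq_1[of j] q_power_neq_1[of "i + j"] q_neq_1 assms
        in \<open>auto simp: power_add\<close>)
qed

lemma nc_series_e_gen_nth: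
  assumes "k \<noteq> Num 0" "m < n"
  shows "fps_nth (nc_series q (e_gen k * x)) m
    = F_term q k m * (\<Sum>i<m. fps_nth (nc_series q x) i)"
proof (cases "m = 0 \<or> k = Hat1")
  \<comment> \<open>At m = 0 the value c_m + (1 - q) is not 1 / [m], but the sum over smaller
    exponents is empty and both sides vanish.\<close>
  case True
  then show ?thesis
  proof
    assume m: "m = 0"
    show ?thesis
      by (cases k) (simp_all add: m mult.assoc nc_series_a_power nc_series_a distrib_right
          distrib_left nc_series_add nc_series_scale[OF q_neq_1] nc_series_b)
  next
    assume "k = Hat1"
    then show ?thesis by (simp add: mult.assoc nc_series_a nc_series_b a_factor_def)
  qed
next
  case False
  with assms obtain p where p: "k = Num (Suc p)"
    by (metis index.exhaust not0_implies_Suc)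
  from False assms have m: "0 < m" "m < n" by auto
  have "fps_nth (nc_series q (e_gen k * x)) m
      = a_factor q m ^ p * (a_factor q m + (1 - q)) * (\<Sum>i<m. fps_nth (nc_series q x) i)"
    by (simp add: p mult.assoc nc_series_a_power nc_series_a distrib_right
          nc_series_add nc_series_scale[OF q_neq_1] nc_series_b)
  also have "a_factor q m ^ p * (a_factor q m + (1 - q)) = F_term q k m"
    by (simp add: p a_factor_plus_hbar[OF m])
       (simp add: a_factor_def power_divide mult.commute flip: power_mult)
  finally show ?thesis .
qed

lemma nc_series_e_word_nth:
  assumes "ks \<in> index_words" "m < n"
  shows "fps_nth (nc_series q (e_word ks)) m = fps_nth (L_series q ks) m"
  using assms
proof (induction ks arbitrary: m)
  case Nil
  then show ?case by (simp add: e_word_def L_series_Nil)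
next
  case (Cons k ks)
  then have "k \<noteq> Num 0" "ks \<in> index_words" by (auto simp: index_words_def)
  with Cons have "fps_nth (nc_series q (e_gen k * e_word ks)) m
      = F_term q k m * (\<Sum>i<m. fps_nth (L_series q ks) i)"
    by (subst nc_series_e_gen_nth) auto
  then show ?case by (simp add: e_word_def L_series_Cons_nth)
qed

text \<open>Lets the coefficients of a^j w be read off letter by letter, without determining its
  coordinates in the e_k.\<close>

lemma u_coeff_eq_nc_series:
  assumes "w \<in> H1hat" "m < n"
  shows "u_coeff q m w = fps_nth (nc_series q w) m"
proof -
  obtain f where f: "w = lin_ext e_word f" "Poly_Mapping.keys f \<subseteq> index_words"
    using assms by (auto simp: H1hat_def)
  show ?thesis
    unfolding u_coeff_def f(1) L_map_lin_ext[OF finite_keys order_refl f(2)]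
    unfolding lin_ext_def
    using f(2) assms(2)
    by (auto simp: nc_series_sum nc_series_scale[OF q_neq_1] fps_sum_nth nc_series_e_word_nth
        intro!: sum.cong)
qed

text \<open>The series counterpart of the rule for two words starting with a, obtained by applying
  \<open>a_factor_mult\<close> to each term of the Cauchy product.\<close>

lemma a_op_mult_nth:
  assumes "m < n" "fps_nth s 0 = 0" "fps_nth t 0 = 0"
  shows "fps_nth (a_op q s * a_op q t) m
    = fps_nth (a_op q (a_op q s * t + s * a_op q t + fps_const (1 - q) * (s * t))) m"
proof -
  have "fps_nth (a_op q s * a_op q t) m
      = (\<Sum>i=0..m. a_factor q m *
          (a_factor q i + a_factor q (m - i) + (1 - q)) * (fps_nth s i * fps_nth t (m - i)))"
    unfolding fps_mult_nth
  proof (rule sum.cong)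
    fix i assume i: "i \<in> {0..m}"
    show "fps_nth (a_op q s) i * fps_nth (a_op q t) (m - i) = a_factor q m *
          (a_factor q i + a_factor q (m - i) + (1 - q)) * (fps_nth s i * fps_nth t (m - i))"
    proof (cases "i = 0 \<or> i = m")
      \<comment> \<open>Interior terms fall under the identity for c_i c_j; the end terms vanish on
        both sides since s and t have no constant term.\<close>
      case False
      then show ?thesis using a_factor_mult[of i "m - i"] i assms(1)
        by (simp add: mult_ac)
    qed (use assms in auto)
  qed simp
  also have "\<dots> = fps_nth (a_op q (a_op q s * t + s * a_op q t + fps_const (1 - q) * (s * t))) m"
    unfolding a_op_nth fps_add_nth fps_mult_left_const_nth
    by (simp add: fps_mult_nth sum_distrib_left distrib_left distrib_right sum.distrib
        mult.assoc mult.left_commute)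
  finally show ?thesis .
qed

text \<open>Induction along the shuffle recursion, for all m < n at once: a acts within exponent m
  and b looks only at smaller exponents, so the bound n is never exceeded.\<close>

lemma nc_series_shuffle_words_nth:
  assumes "u = [] \<or> last u = B" "v = [] \<or> last v = B" "m < n"
  shows "fps_nth (nc_series q (shuffle_words u v)) m
    = fps_nth (word_series q u * word_series q v) m"
  using assms
proof (induction u v arbitrary: m rule: shuffle_words.induct)
  case (3 u x v)
  then have "fps_nth (nc_series q (shuffle_words u (x # v))) i
      = fps_nth (word_series q u * word_series q (x # v)) i" if "i < n" for i
    using that by (auto split: if_splits)
  with 3(4) show ?case by (simp add: nc_series_b b_op_mult_left)
next
  case (4 u v)
  then have "fps_nth (nc_series q (shuffle_words (A # u) v)) i
      = fps_nth (word_series q (A # u) * word_series q v) i" if "i < n" for i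
    using that by (auto split: if_splits)
  with 4(4) show ?case by (simp add: nc_series_b b_op_mult_right)
next
  case (5 u v)
  then have ne: "u \<noteq> []" "v \<noteq> []" and last: "last u = B" "last v = B"
    by (auto split: if_splits)
  from 5 ne last show ?case
    by (simp add: nc_series_a nc_series_add nc_series_scale[OF q_neq_1] a_op_mult_nth
        word_series_nth_0)
qed (simp_all add: nc_series_single)

lemma nc_series_shuffle_nth:
  assumes "x \<in> Hb" "y \<in> Hb" "m < n"
  shows "fps_nth (nc_series q (x \<squnion>\<squnion> y)) m = fps_nth (nc_series q x * nc_series q y) m"
proof -
  have "fps_nth (nc_series q ((x * gen_b) \<squnion>\<squnion> (y * gen_b))) m
      = fps_nth (nc_series q (x * gen_b) * nc_series q (y * gen_b)) m" for x y
  proof (induction x rule: poly_mapping_single_induct)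
    case (single u c)
    show ?case
    proof (induction y rule: poly_mapping_single_induct)
      case (single v d)
      have swap: "fps_const a * s * (fps_const b * t) = fps_const (a * b) * (s * t)"
        for a b :: complex and s t
        by (simp add: mult_ac flip: fps_const_mult)
      show ?case
        by (simp add: single_mult_gen_b shuffle_single nc_series_scale[OF q_neq_1]
            nc_series_single swap eval_hbar_mult[OF q_neq_1]
            nc_series_shuffle_words_nth[OF _ _ assms(3)])
    qed (simp_all add: distrib_right distrib_left shuffle_add_right nc_series_add)
  qed (simp_all add: distrib_right shuffle_add_left nc_series_add)
  with assms show ?thesis by (auto simp: Hb_def)
qed

end

section \<open>Sums over compositions\<close>

text \<open>The explicit zero at m = 0 encodes that parts of compositions are positive; for k = 0
  the value of \<open>F_term\<close> there would be 1.\<close>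

definition F_series :: "complex \<Rightarrow> nat \<Rightarrow> complex fps" where
  "F_series q k = Abs_fps (\<lambda>m. if m = 0 then 0 else F_term q (Num k) m)"

lemma F_series_nth:
  "fps_nth (F_series q k) m = (if m = 0 then 0 else F_term q (Num k) m)"
  by (simp add: F_series_def)

lemma compositions_Suc:
  "compositions (Suc r) n = (\<Union>m\<in>{1..n}. (#) m ` compositions r (n - m))"
  by (force simp: compositions_def length_Suc_conv image_iff)

text \<open>The Cauchy product collects ordered tuples by their sum, so compositions are counted by
  a product of generating series.\<close>

lemma omega_eq_nth: "omega n ks q = fps_nth (prod_list (map (F_series q) ks)) n"
proof (induction ks arbitrary: n)
  case Nil
  show ?case by (auto simp: omega_def compositions_def cong: conj_cong)
next
  case (Cons k ks)
  have "omega n (k # ks) q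
      = (\<Sum>m=1..n. \<Sum>ms\<in>(#) m ` compositions (length ks) (n - m).
          \<Prod>l<Suc (length ks). q ^ (((k # ks) ! l - 1) * (ms ! l)) / qint q (ms ! l) ^ ((k # ks) ! l))"
    unfolding omega_def
    by (simp add: compositions_Suc, subst sum.UNION_disjoint)
       (auto simp: finite_compositions)
  also have "\<dots> = (\<Sum>m=1..n. F_term q (Num k) m * omega (n - m) ks q)"
    by (rule sum.cong)
       (simp_all add: sum.reindex prod.lessThan_Suc_shift omega_def sum_distrib_left
          del: prod.lessThan_Suc)
  also have "\<dots> = (\<Sum>m=0..n. fps_nth (F_series q k) m * omega (n - m) ks q)"
    by (rule sum.mono_neutral_cong_left) (auto simp: F_series_nth)
  finally show ?case by (simp add: Cons fps_mult_nth)
qed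

section \<open>Shuffle products of the e_k and the binomial sum\<close>

context q_order_at_least
begin

lemma nc_series_e_gen_Num_nth:
  assumes "k \<ge> 1" "m < n"
  shows "fps_nth (nc_series q (e_gen (Num k))) m = fps_nth (F_series q k) m"
proof -
  have "(\<Sum>i<m. fps_nth (1 :: complex fps) i) = (if m = 0 then 0 else 1)"
    by (simp add: sum.delta)
  then show ?thesis
    using nc_series_e_gen_nth[of "Num k" m 1] assms by (simp add: F_series_nth)
qed

lemma nc_series_shuffle_list_nth:
  assumes "ks \<noteq> []" "\<forall>k\<in>set ks. k \<ge> 1" "m < n"
  shows "fps_nth (nc_series q (shuffle_list (map (\<lambda>k. e_gen (Num k)) ks))) m = omega m ks q"
  unfolding omega_eq_nth using assms
proof (induction ks arbitrary: m rule: list_nonempty_induct)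
  case (single k)
  then show ?case using nc_series_e_gen_Num_nth
    by (simp add: shuffle_list_def shuffle_1_right del: e_gen.simps)
next
  case (cons k ks)
  let ?w = "shuffle_list (map (\<lambda>k. e_gen (Num k)) ks)"
  have "?w \<in> Hb"
    using shuffle_list_in_Hb[of "map Num ks"] cons(1) by (simp add: comp_def del: e_gen.simps)
  then have "fps_nth (nc_series q (e_gen (Num k) \<squnion>\<squnion> ?w)) m
      = fps_nth (nc_series q (e_gen (Num k)) * nc_series q ?w) m"
    using cons.prems(2) by (intro nc_series_shuffle_nth e_gen_in_Hb)
  \<comment> \<open>The coefficient at m involves only exponents up to m < n, where both factors are
    already known.\<close>
  also have "\<dots> = fps_nth (F_series q k * prod_list (map (F_series q) ks)) m"
    unfolding fps_mult_nth
    using cons.prems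
    by (intro sum.cong) (auto simp: cons.IH nc_series_e_gen_Num_nth simp del: e_gen.simps)
  finally show ?case by (simp add: shuffle_list_def)
qed

lemma sum_binomial_a_factor:
  assumes "k \<ge> 1" "0 < m" "m < n"
  shows "(\<Sum>j=1..k. of_nat ((k - 1) choose (j - 1)) * (1 - q) ^ (k - j) * a_factor q m ^ j)
    = q ^ m / qint q m ^ k"
proof -
  obtain p where p: "k = Suc p" using assms(1) by (cases k) auto
  have "(\<Sum>j=1..k. of_nat ((k - 1) choose (j - 1)) * (1 - q) ^ (k - j) * a_factor q m ^ j)
      = (\<Sum>j\<le>p. of_nat (p choose j) * (1 - q) ^ (p - j) * a_factor q m ^ Suc j)"
    unfolding p One_nat_def sum.shift_bounds_cl_Suc_ivl by (simp add: atLeast0AtMost)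
  also have "\<dots> = a_factor q m * (a_factor q m + (1 - q)) ^ p"
    unfolding binomial_ring sum_distrib_left by (rule sum.cong) (simp_all add: mult_ac)
  also have "\<dots> = q ^ m / qint q m ^ k"
    unfolding a_factor_plus_hbar[OF assms(2,3)] by (simp add: a_factor_def p power_divide)
  finally show ?thesis .
qed

end

text \<open>Put y = q^(n-m), the inverse of q^m. Then [n-m] = -y [m], and y^(k-1) / (-y)^k = (-1)^k
  / y = (-1)^k q^m.\<close>

lemma F_term_reflect:
  assumes "q ^ n = 1" "k \<ge> 1" "m \<le> n"
  shows "F_term q (Num k) (n - m) = (- 1) ^ k * (q ^ m / qint q m ^ k)"
proof -
  define x where "x = q ^ m"
  define y where "y = q ^ (n - m)"
  have xy: "x * y = 1"
    using assms by (simp add: x_def y_def flip: power_add)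
  then have "y \<noteq> 0" "x = inverse y" by (auto intro: inverse_unique[symmetric] simp: mult.commute)
  have qint: "qint q (n - m) = - y * qint q m"
    using xy by (simp add: qint_def flip: x_def y_def)
      (simp add: algebra_simps minus_divide_left flip: diff_divide_distrib)
  obtain p where p: "k = Suc p" using assms(2) by (cases k) auto
  have "q ^ (p * (n - m)) = y ^ p"
    by (simp add: y_def mult.commute flip: power_mult)
  then have "F_term q (Num k) (n - m) = y ^ p / ((- 1) ^ k * (y ^ p * y) * qint q m ^ k)"
    unfolding qint F_term.simps p power_mult_distrib power_minus[of y] by (simp add: mult_ac)
  also have "\<dots> = (- 1) ^ k * (x / qint q m ^ k)"
    using \<open>y \<noteq> 0\<close> unfolding \<open>x = inverse y\<close>
    by (cases "even k") (simp_all add: field_simps)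
  finally show ?thesis by (simp add: x_def)
qed

theorem theorem4p4:
  fixes n :: nat and \<zeta> :: complex and ks :: "nat list"
  assumes "length ks \<ge> 2"
    and "\<forall>k\<in>set ks. k \<ge> 1"
    and "primitive_root_of_unity n \<zeta>"
  shows "omega n ks \<zeta> =
    (- 1) ^ last ks *
    (\<Sum>j = 1..last ks. of_nat ((last ks - 1) choose (j - 1)) * (1 - \<zeta>) ^ (last ks - j) *
       z_sum \<zeta> n (gen_a ^ j * shuffle_list (map (\<lambda>k. e_gen (Num k)) (butlast ks))))"
proof (cases "n = 1")
  case True
  \<comment> \<open>For n = 1 the root is 1 and hbar acts as 0, so this case is separate: two or
    more positive parts cannot sum to 1, and each \<open>z_sum\<close> is empty.\<close>
  have "compositions (length ks) 1 = {}"
  proof -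
    have "length ms \<le> sum_list ms" if "\<forall>x\<in>set ms. x > 0" for ms :: "nat list"
      using that by (induction ms) auto
    then show ?thesis using assms(1) by (fastforce simp: compositions_def)
  qed
  with True show ?thesis by (simp add: omega_def z_sum_def)
next
  case False
  from assms(3) have root: "\<zeta> ^ n = 1" "n > 0" "\<And>m. 0 < m \<Longrightarrow> m < n \<Longrightarrow> \<zeta> ^ m \<noteq> 1"
    by (auto simp: primitive_root_of_unity_def)
  interpret q_order_at_least \<zeta> n
    by standard (use root(3)[of 1] root False in auto)
  define k where "k = last ks"
  define ls where "ls = butlast ks"
  let ?w = "shuffle_list (map (\<lambda>k. e_gen (Num k)) ls)"
  let ?c = "\<lambda>j. of_nat ((k - 1) choose (j - 1)) * (1 - \<zeta>) ^ (k - j)"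
  have ks: "ks = ls @ [k]" "ls \<noteq> []"
    using assms(1) by (cases ks rule: rev_cases; auto simp: k_def ls_def)+
  then have k: "k \<ge> 1" and ls: "\<forall>k\<in>set ls. k \<ge> 1"
    using assms(2) by auto
  have "?w \<in> Hb"
    using shuffle_list_in_Hb[of "map Num ls"] ks(2) by (simp add: comp_def del: e_gen.simps)
  then have "gen_a ^ j * ?w \<in> H1hat" for j
    using Hb_subset_H1hat Hb_mult_left by blast
  then have u: "u_coeff \<zeta> m (gen_a ^ j * ?w) = a_factor \<zeta> m ^ j * omega m ls \<zeta>" if "m < n" for j m
    using that ks(2) ls
    by (simp add: u_coeff_eq_nc_series nc_series_a_power nc_series_shuffle_list_nth
        del: e_gen.simps)
  have "(- 1) ^ k * (\<Sum>j=1..k. ?c j * z_sum \<zeta> n (gen_a ^ j * ?w))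
      = (- 1) ^ k * (\<Sum>j=1..k. \<Sum>m=1..<n. ?c j * a_factor \<zeta> m ^ j * omega m ls \<zeta>)"
    by (simp add: z_sum_def u sum_distrib_left mult.assoc del: e_gen.simps)
  also have "\<dots> = (\<Sum>m=1..<n. (- 1) ^ k * ((\<Sum>j=1..k. ?c j * a_factor \<zeta> m ^ j) * omega m ls \<zeta>))"
    by (subst sum.swap) (simp add: sum_distrib_left sum_distrib_right)
  \<comment> \<open>Reflection turns the collapsed binomial sum into the weight of a last part n -
    m, while m is the sum of the other parts.\<close>
  also have "\<dots> = (\<Sum>m=1..<n. omega m ls \<zeta> * F_term \<zeta> (Num k) (n - m))"
  proof (rule sum.cong)
    fix m assume "m \<in> {1..<n}"
    then show "(- 1) ^ k * ((\<Sum>j=1..k. ?c j * a_factor \<zeta> m ^ j) * omega m ls \<zeta>)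
        = omega m ls \<zeta> * F_term \<zeta> (Num k) (n - m)"
      using sum_binomial_a_factor[OF k, of m] F_term_reflect[OF root(1) k, of m]
      by (simp del: F_term.simps)
  qed simp
  \<comment> \<open>Completing the range to a Cauchy product adds only zeros: at m = 0 because
    \<open>ls\<close> is nonempty, at m = n because \<open>F_series\<close> has no constant
    term.\<close>
  also have "\<dots> = (\<Sum>m=0..n. omega m ls \<zeta> * fps_nth (F_series \<zeta> k) (n - m))"
  proof (rule sum.mono_neutral_cong_left)
    have "omega 0 ls \<zeta> = 0"
      using ks(2) by (cases ls) (simp_all add: omega_eq_nth F_series_nth)
    then show "\<forall>i\<in>{0..n} - {1..<n}. omega i ls \<zeta> * fps_nth (F_series \<zeta> k) (n - i) = 0"
      by (auto simp: F_series_nth not_less_eq_eq)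
  qed (auto simp: F_series_nth)
  also have "\<dots> = omega n ks \<zeta>"
    by (simp add: omega_eq_nth ks(1) fps_mult_nth)
  finally show ?thesis by (simp add: k_def ls_def)
qed

end
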